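(* (i) Let $\alpha(u)=(u,0,z(u))$, $u>0$, be a $C^2$ curve, let $\eta=\mathrm{sgn}(1-z'^2)\in\{-1,1\}$, and let $S$ be the skew curvature of the surface of revolution in $\mathbb{E}_1^3$ obtained by rotating $\alpha$ around the timelike $z$-axis. Put $A=\dfrac{z'}{u\sqrt{\eta(1-z'^2)}}$. Then $S^2=\dfrac{u^2}{4}A'^2$, and $A$ can be written in terms of the skew curvature as $$A(u)=\pm2\int\frac{S(v)}{v}\,dv+a_0,$$ where $a_0$ is a constant of integration. Moreover, $$z'^2=\frac{\eta\,u^2A^2}{1+\eta\,u^2A^2},\qquad z(u)=\pm\int\frac{vA(v)}{\sqrt{\eta+v^2A(v)^2}}\,dv+z_0,$$ where $z_0$ is another constant of integration. (ii) Conversely, for a prescribed function $S$, the graph of a function $z$ given by these formulas, that is, $z(u)=\pm\int\frac{vA(v)}{\sqrt{\eta+v^2A(v)^2}}\,dv+z_0$ with $A(u)=\pm2\int\frac{S(v)}{v}\,dv+a_0$, gives rise to a surface of revolution with prescribed skew curvature $S$ when the curve $\alpha(u)=(u,0,z(u))$ is rotated around the timelike $z$-axis.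
   Context: $\mathbb{E}_1^3$ is $\mathbb{R}^3$ with coordinates $(x,y,z)$ and the metric $\langle u,v\rangle=u_1v_1+u_2v_2-u_3v_3$. Rotating $\alpha(u)=(u,0,z(u))$ around the $z$-axis gives $Z(u,\theta)=(u\cos\theta,u\sin\theta,z(u))$. For a non-lightlike parametrized surface $X$ with unit normal $N$, put $\epsilon=\langle N,N\rangle\in\{-1,1\}$ and let $g_{ij}$, $h_{ij}$ be the coefficients of the first and second fundamental forms (for parameters $u,v$: $g_{11}=\langle X_u,X_u\rangle$, $g_{12}=\langle X_u,X_v\rangle$, $g_{22}=\langle X_v,X_v\rangle$, $h_{11}=\langle X_{uu},N\rangle$, $h_{12}=\langle X_{uv},N\rangle$, $h_{22}=\langle X_{vv},N\rangle$). The Gaussian, mean and skew curvatures are $$K=\epsilon\,\frac{h_{11}h_{22}-h_{12}^2}{g_{11}g_{22}-g_{12}^2},\qquad H=\frac{\epsilon}{2}\,\frac{g_{11}h_{22}-2g_{12}h_{12}+g_{22}h_{11}}{g_{11}g_{22}-g_{12}^2},\qquad S=\sqrt{H^2-\epsilon K}.$$ For these surfaces $\epsilon=-\eta$, $H^2-\epsilon K\ge0$, and $S$ depends only on $u$. Each $\int\cdots dv$ denotes an antiderivative evaluated at $u$.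
   Formalization: The ± in A=±2∫S/v dv+a₀ is a sign depending on v under the integral (constant wherever S has no zero), since one global sign fails, e.g. for A=(u-1)² with S=u|u-1|; in (ii) the prescribed S is assumed nonnegative, as S is a square root. *)

theory Defs
  imports "HOL-Analysis.Analysis"
begin

section \<open>Lorentz-Minkowski space\<close>

definition lorentz :: "real^3 \<Rightarrow> real^3 \<Rightarrow> real" where
  "lorentz a b = a$1 * b$1 + a$2 * b$2 - a$3 * b$3"

(* Characterised by lorentz (lorentz_cross a b) w = det (a, b, w). *)
definition lorentz_cross :: "real^3 \<Rightarrow> real^3 \<Rightarrow> real^3" where
  "lorentz_cross a b = vector [a$2 * b$3 - a$3 * b$2,
                               a$3 * b$1 - a$1 * b$3,
                               a$2 * b$1 - a$1 * b$2]"


section \<open>Parametrized surfaces\<close>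

type_synonym surface = "real \<Rightarrow> real \<Rightarrow> real^3"

definition partial_u :: "surface \<Rightarrow> surface" where
  "partial_u X u v = vector_derivative (\<lambda>t. X t v) (at u)"

definition partial_v :: "surface \<Rightarrow> surface" where
  "partial_v X u v = vector_derivative (\<lambda>t. X u t) (at v)"

(* Meaningful where the surface is non-lightlike. The opposite choice of sign changes
   the sign of the mean curvature, but neither the Gaussian nor the skew curvature. *)
definition unit_normal :: "surface \<Rightarrow> surface" where
  "unit_normal X u v =
     (let n = lorentz_cross (partial_u X u v) (partial_v X u v)
      in (1 / sqrt \<bar>lorentz n n\<bar>) *\<^sub>R n)"

definition normal_sign :: "surface \<Rightarrow> real \<Rightarrow> real \<Rightarrow> real" where
  "normal_sign X u v = lorentz (unit_normal X u v) (unit_normal X u v)"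

definition g11 :: "surface \<Rightarrow> real \<Rightarrow> real \<Rightarrow> real" where
  "g11 X u v = lorentz (partial_u X u v) (partial_u X u v)"
definition g12 :: "surface \<Rightarrow> real \<Rightarrow> real \<Rightarrow> real" where
  "g12 X u v = lorentz (partial_u X u v) (partial_v X u v)"
definition g22 :: "surface \<Rightarrow> real \<Rightarrow> real \<Rightarrow> real" where
  "g22 X u v = lorentz (partial_v X u v) (partial_v X u v)"

definition h11 :: "surface \<Rightarrow> real \<Rightarrow> real \<Rightarrow> real" where
  "h11 X u v = lorentz (partial_u (partial_u X) u v) (unit_normal X u v)"
definition h12 :: "surface \<Rightarrow> real \<Rightarrow> real \<Rightarrow> real" where
  "h12 X u v = lorentz (partial_v (partial_u X) u v) (unit_normal X u v)"
definition h22 :: "surface \<Rightarrow> real \<Rightarrow> real \<Rightarrow> real" where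
  "h22 X u v = lorentz (partial_v (partial_v X) u v) (unit_normal X u v)"

definition gauss_curvature :: "surface \<Rightarrow> real \<Rightarrow> real \<Rightarrow> real" where
  "gauss_curvature X u v =
     normal_sign X u v * ((h11 X u v * h22 X u v - (h12 X u v)\<^sup>2)
                        / (g11 X u v * g22 X u v - (g12 X u v)\<^sup>2))"

definition mean_curvature :: "surface \<Rightarrow> real \<Rightarrow> real \<Rightarrow> real" where
  "mean_curvature X u v =
     normal_sign X u v / 2 *
       ((g11 X u v * h22 X u v - 2 * g12 X u v * h12 X u v + g22 X u v * h11 X u v)
        / (g11 X u v * g22 X u v - (g12 X u v)\<^sup>2))"

definition skew_discriminant :: "surface \<Rightarrow> real \<Rightarrow> real \<Rightarrow> real" where
  "skew_discriminant X u v =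
     (mean_curvature X u v)\<^sup>2 - normal_sign X u v * gauss_curvature X u v"

(* Isabelle's sqrt is odd on the reals, so this is the skew curvature
   only where the discriminant is nonnegative. *)
definition skew_curvature :: "surface \<Rightarrow> real \<Rightarrow> real \<Rightarrow> real" where
  "skew_curvature X u v = sqrt (skew_discriminant X u v)"

lemma lorentz_cross_det: "lorentz (lorentz_cross a b) w = det (vector [a, b, w])"
  by (simp add: lorentz_def lorentz_cross_def det_3 algebra_simps)

lemma unit_normal_orthogonal:
  "lorentz (unit_normal X u v) (partial_u X u v) = 0"
  "lorentz (unit_normal X u v) (partial_v X u v) = 0"
proof -
  have scale: "lorentz (c *\<^sub>R a) b = c * lorentz a b" for c a b
    by (simp add: lorentz_def algebra_simps)
  have "lorentz (lorentz_cross a b) a = 0" "lorentz (lorentz_cross a b) b = 0" for a b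
    by (simp_all add: lorentz_def lorentz_cross_def algebra_simps)
  then show "lorentz (unit_normal X u v) (partial_u X u v) = 0"
    and "lorentz (unit_normal X u v) (partial_v X u v) = 0"
    by (simp_all add: unit_normal_def Let_def scale)
qed

lemma normal_sign_eq:
  "normal_sign X u v = - sgn (g11 X u v * g22 X u v - (g12 X u v)\<^sup>2)"
proof -
  define n where "n = lorentz_cross (partial_u X u v) (partial_v X u v)"
  have scale: "lorentz (c *\<^sub>R n) (c *\<^sub>R n) = c\<^sup>2 * lorentz n n" for c
    by (simp add: lorentz_def power2_eq_square algebra_simps)
  have "normal_sign X u v = lorentz n n / \<bar>lorentz n n\<bar>"
    by (simp add: normal_sign_def unit_normal_def Let_def scale power_divide flip: n_def)
  also have "\<dots> = sgn (lorentz n n)"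
    by (simp add: sgn_if)
  also have "lorentz n n = - (g11 X u v * g22 X u v - (g12 X u v)\<^sup>2)"
    by (simp add: n_def lorentz_def lorentz_cross_def g11_def g12_def g22_def
        power2_eq_square algebra_simps)
  finally show ?thesis
    by (simp only: sgn_minus)
qed


section \<open>Surfaces of revolution about the timelike axis\<close>

definition profile_curve :: "(real \<Rightarrow> real) \<Rightarrow> real \<Rightarrow> real^3" where
  "profile_curve z u = vector [u, 0, z u]"

definition rotate_z :: "real \<Rightarrow> real^3 \<Rightarrow> real^3" where
  "rotate_z \<theta> p = vector [cos \<theta> * p$1 - sin \<theta> * p$2, sin \<theta> * p$1 + cos \<theta> * p$2, p$3]"

definition revolution :: "(real \<Rightarrow> real^3) \<Rightarrow> surface" where
  "revolution \<alpha> u \<theta> = rotate_z \<theta> (\<alpha> u)"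

lemma revolution_profile_curve:
  "revolution (profile_curve z) u \<theta> = vector [u * cos \<theta>, u * sin \<theta>, z u]"
  by (simp add: revolution_def rotate_z_def profile_curve_def mult.commute)


section \<open>Regularity and antiderivatives\<close>

(* Two-sided derivatives: intended for open I. *)
definition C2_on :: "real set \<Rightarrow> (real \<Rightarrow> 'a::real_normed_vector) \<Rightarrow> bool" where
  "C2_on I \<alpha> \<longleftrightarrow>
     (\<exists>\<alpha>' \<alpha>''. (\<forall>u\<in>I. (\<alpha> has_vector_derivative \<alpha>' u) (at u) \<and>
                    (\<alpha>' has_vector_derivative \<alpha>'' u) (at u)) \<and>
              continuous_on I \<alpha>'')"

definition antiderivative_on :: "real set \<Rightarrow> (real \<Rightarrow> real) \<Rightarrow> (real \<Rightarrow> real) \<Rightarrow> bool" where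
  "antiderivative_on I f F \<longleftrightarrow> (\<forall>u\<in>I. (F has_real_derivative f u) (at u))"

(* The sign in A = \<plusminus> 2 \<integral> S(v)/v dv + a_0.  The skew curvature is nonnegative, so A' = \<plusminus> 2 S(u)/u
   with a sign that may have to switch at zeros of S: for A = (u - 1)^2 no global sign works.
   The sign is therefore a function of v under the integral; a constant one gives the
   formula with a global sign. *)
definition sign_function_on :: "real set \<Rightarrow> (real \<Rightarrow> real) \<Rightarrow> bool" where
  "sign_function_on I \<sigma> \<longleftrightarrow> (\<forall>v\<in>I. \<sigma> v \<in> {-1, 1})"

end

(* The coordinate curves are lines of curvature, and up to one common sign the principal curvatures
   are A (along the parallels) and (u A)' = A + u A' (along the profile curve). Hence H^2 - epsilon K,
   a quarter of the squared difference of the principal curvatures, equals u^2 A'^2 / 4, and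
   A' = +-2 S / u. The sign is sgn A'. As A' is a derivative, it has the intermediate value property,
   so the sign is constant on intervals where S does not vanish, and A' is continuous as soon as
   S = u |A'| / 2 is; the latter makes the profile C^2 in the converse. *)
theory Submission
  imports Defs
begin

section \<open>Preliminaries: curves in space and the Darboux property of derivatives\<close>

lemma has_vector_derivative_vector_3:
  fixes f g h :: "real \<Rightarrow> real"
  assumes "(f has_real_derivative f') F" "(g has_real_derivative g') F" "(h has_real_derivative h') F"
  shows "((\<lambda>t. vector [f t, g t, h t] :: real^3) has_vector_derivative vector [f', g', h']) F"
proof -
  have eq: "vector [a, b, c] = a *\<^sub>R axis 1 1 + b *\<^sub>R axis 2 1 + c *\<^sub>R (axis 3 1 :: real^3)" for a b c :: real
    by (simp add: vec_eq_iff forall_3 axis_def)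
  show ?thesis
    unfolding eq using assms
    by (intro has_vector_derivative_add)
       (auto intro!: derivative_eq_intros simp: has_vector_derivative_def has_field_derivative_def fun_eq_iff)
qed

text \<open>The maximum of \<open>f\<close> on the compact interval is not at an end point, since
  \<open>f\<close> rises to the right of \<open>a\<close> and falls towards \<open>b\<close>. It is
  therefore interior, and Fermat's criterion applies. Continuity of \<open>f'\<close> does not
  enter.\<close>

lemma derivative_zero_between:
  fixes f :: "real \<Rightarrow> real"
  assumes "a < b" and f: "\<And>x. x \<in> {a..b} \<Longrightarrow> (f has_real_derivative f' x) (at x)"
    and "0 < f' a" "f' b < 0"
  shows "\<exists>c\<in>{a<..<b}. f' c = 0"
proof -
  have "continuous_on {a..b} f"
    using f by (intro continuous_at_imp_continuous_on ballI DERIV_isCont)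
  then obtain c where c: "c \<in> {a..b}" "\<And>x. x \<in> {a..b} \<Longrightarrow> f x \<le> f c"
    using \<open>a < b\<close> continuous_attains_sup[of "{a..b}" f] by auto
  obtain d where d: "d > 0" "\<And>h. 0 < h \<Longrightarrow> h < d \<Longrightarrow> f a < f (a + h)"
    using DERIV_pos_inc_right[OF f[of a]] assms by auto
  obtain e where e: "e > 0" "\<And>h. 0 < h \<Longrightarrow> h < e \<Longrightarrow> f b < f (b - h)"
    using DERIV_neg_dec_left[OF f[of b]] assms by auto
  have "c \<noteq> a"
  proof -
    \<comment> \<open>A step short enough for the local growth at \<open>a\<close> and for staying
      inside the interval.\<close>
    define h where "h = min (d / 2) (b - a)"
    have "0 < h" "h < d" "h \<le> b - a" using \<open>a < b\<close> \<open>d > 0\<close> by (auto simp: h_def)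
    then show ?thesis using d(2)[of h] c(2)[of "a + h"] by auto
  qed
  moreover have "c \<noteq> b"
  proof -
    define h where "h = min (e / 2) (b - a)"
    have "0 < h" "h < e" "h \<le> b - a" using \<open>a < b\<close> \<open>e > 0\<close> by (auto simp: h_def)
    then show ?thesis using e(2)[of h] c(2)[of "b - h"] by auto
  qed
  ultimately have cc: "c \<in> {a<..<b}" using c(1) by auto
  have "f' c = 0"
  proof (rule DERIV_local_max[OF f[OF c(1)]])
    show "0 < min (c - a) (b - c)" using cc by auto
    show "\<forall>y. \<bar>c - y\<bar> < min (c - a) (b - c) \<longrightarrow> f y \<le> f c"
      by (intro allI impI c(2)) auto
  qed
  with cc show ?thesis by blast
qed

text \<open>A change of sign in either direction would force a zero of \<open>f'\<close> in between,
  by the previous lemma for \<open>f\<close> or for \<open>- f\<close>.\<close>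

lemma sgn_derivative_constant:
  fixes f :: "real \<Rightarrow> real"
  assumes J: "is_interval J" and f: "\<And>x. x \<in> J \<Longrightarrow> (f has_real_derivative f' x) (at x)"
    and nz: "\<And>x. x \<in> J \<Longrightarrow> f' x \<noteq> 0" and "x \<in> J" "y \<in> J"
  shows "sgn (f' x) = sgn (f' y)"
proof -
  have *: "sgn (f' a) = sgn (f' b)" if "a < b" "a \<in> J" "b \<in> J" for a b
  proof (rule ccontr)
    assume neq: "sgn (f' a) \<noteq> sgn (f' b)"
    have sub: "{a..b} \<subseteq> J"
      using mem_is_interval_1_I[OF J that(2,3)] by auto
    from neq nz[OF that(2)] nz[OF that(3)]
    consider "f' a > 0" "f' b < 0" | "- f' a > 0" "- f' b < 0"
      by (auto simp: sgn_if split: if_splits)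
    then have "\<exists>c\<in>{a<..<b}. f' c = 0"
    proof cases
      case 1
      with \<open>a < b\<close> show ?thesis
        by (intro derivative_zero_between[of a b f] f) (use sub in blast)+
    next
      case 2
      have "\<exists>c\<in>{a<..<b}. - f' c = 0"
        using 2 \<open>a < b\<close>
        by (intro derivative_zero_between[of a b "\<lambda>x. - f x"] DERIV_minus f) (use sub in blast)+
      then show ?thesis by simp
    qed
    then obtain c where "a < c" "c < b" "f' c = 0" by auto
    then show False using nz[of c] subsetD[OF sub, of c] by auto
  qed
  show ?thesis
    using assms(4,5) by (metis * linorder_less_linear)
qed

text \<open>At a zero of \<open>f'\<close>, convergence of the absolute value to 0 is convergence of
  \<open>f'\<close> itself. Elsewhere continuity of the absolute value keeps \<open>f'\<close> away
  from 0 on a ball; its sign is constant there, so \<open>f'\<close> is locally a constant multiple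
  of its absolute value.\<close>

lemma continuous_on_derivative_if_abs:
  fixes f :: "real \<Rightarrow> real"
  assumes "open I" and f: "\<And>x. x \<in> I \<Longrightarrow> (f has_real_derivative f' x) (at x)"
    and cont: "continuous_on I (\<lambda>x. \<bar>f' x\<bar>)"
  shows "continuous_on I f'"
proof -
  have "isCont f' x" if x: "x \<in> I" for x
  proof -
    have lim: "isCont (\<lambda>y. \<bar>f' y\<bar>) x"
      using cont \<open>open I\<close> x by (simp add: continuous_on_eq_continuous_at)
    show ?thesis
    proof (cases "f' x = 0")
      case True
      then show ?thesis using lim by (simp add: isCont_def tendsto_rabs_zero_iff)
    next
      case False
      have "\<forall>\<^sub>F y in nhds x. 0 < \<bar>f' y\<bar> \<and> y \<in> I"
      proof (rule eventually_conj)
        have "((\<lambda>y. \<bar>f' y\<bar>) \<longlongrightarrow> \<bar>f' x\<bar>) (nhds x)"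
          using lim tendsto_at_iff_tendsto_nhds[of "\<lambda>y. \<bar>f' y\<bar>" x] by (simp add: isCont_def)
        then show "\<forall>\<^sub>F y in nhds x. 0 < \<bar>f' y\<bar>"
          by (rule order_tendstoD(1)) (use False in simp)
      qed (rule eventually_nhds_in_open[OF \<open>open I\<close> x])
      then obtain d where d: "d > 0" "\<And>y. y \<in> ball x d \<Longrightarrow> f' y \<noteq> 0 \<and> y \<in> I"
        by (auto simp: eventually_nhds_metric dist_commute)
      have "f' y = sgn (f' x) * \<bar>f' y\<bar>" if "y \<in> ball x d" for y
        using sgn_derivative_constant[of "ball x d" f f' x y] f d that
        by (auto simp: is_interval_ball_real abs_sgn mult.commute mult_sgn_abs)
      then have "\<forall>\<^sub>F y in nhds x. f' y = sgn (f' x) * \<bar>f' y\<bar>"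
        using d(1) by (auto simp: eventually_nhds_metric dist_commute intro!: exI[of _ d])
      moreover have "isCont (\<lambda>y. sgn (f' x) * \<bar>f' y\<bar>) x"
        by (intro continuous_mult continuous_const lim)
      ultimately show ?thesis by (simp add: isCont_cong)
    qed
  qed
  then show ?thesis by (simp add: continuous_at_imp_continuous_on)
qed

section \<open>The skew curvature of a surface of revolution\<close>

text \<open>Both fundamental forms are diagonal. With m = 1 - p^2 and w^2 = |m|, the principal
  curvatures are, up to a common sign, q / (w m) and p / (u w); the right-hand side is a quarter of
  their squared difference.\<close>

lemma skew_discriminant_revolution:
  assumes u: "0 < u" and z: "\<forall>\<^sub>F t in nhds u. (z has_real_derivative p t) (at t)"
    and p: "(p has_real_derivative q) (at u)" and e: "\<eta> = sgn (1 - (p u)\<^sup>2)" "\<eta> \<in> {-1, 1}"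
  shows "skew_discriminant (revolution (profile_curve z)) u \<theta> =
    (u * q - p u * (1 - (p u)\<^sup>2))\<^sup>2 / (4 * u\<^sup>2 * (\<eta> * (1 - (p u)\<^sup>2)) * (1 - (p u)\<^sup>2)\<^sup>2)"
proof -
  let ?X = "revolution (profile_curve z)"
  have X: "?X = (\<lambda>u \<theta>. vector [u * cos \<theta>, u * sin \<theta>, z u])"
    by (simp add: revolution_profile_curve fun_eq_iff)
  have Xu: "partial_u ?X t \<phi> = vector [cos \<phi>, sin \<phi>, p t]"
    if "(z has_real_derivative p t) (at t)" for t \<phi>
    unfolding partial_u_def X
    by (rule vector_derivative_at, rule has_vector_derivative_vector_3)
       (auto intro!: derivative_eq_intros that)
  have Xv: "partial_v ?X t \<phi> = vector [- t * sin \<phi>, t * cos \<phi>, 0]" for t \<phi>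
    unfolding partial_v_def X
    by (rule vector_derivative_at, rule has_vector_derivative_vector_3)
       (auto intro!: derivative_eq_intros)
  have zu: "(z has_real_derivative p u) (at u)"
    using z by (rule eventually_nhds_x_imp_x)
  \<comment> \<open>Differentiating \<open>partial_u ?X\<close> once more requires its formula on a
    neighbourhood of \<open>u\<close>, not only at \<open>u\<close>.\<close>
  have Xuu: "partial_u (partial_u ?X) u \<theta> = vector [0, 0, q]"
  proof -
    have "((\<lambda>t. vector [cos \<theta>, sin \<theta>, p t] :: real^3) has_vector_derivative vector [0, 0, q]) (at u)"
      by (rule has_vector_derivative_vector_3) (auto intro!: derivative_eq_intros p)
    moreover have "\<forall>\<^sub>F t in nhds u. partial_u ?X t \<theta> = vector [cos \<theta>, sin \<theta>, p t]"
      using z by eventually_elim (rule Xu)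
    ultimately have "((\<lambda>t. partial_u ?X t \<theta>) has_vector_derivative vector [0, 0, q]) (at u)"
      by (subst has_vector_derivative_cong_ev[where g = "\<lambda>t. vector [cos \<theta>, sin \<theta>, p t]"])
         (auto simp: Xu[OF zu] elim: eventually_mono)
    then show ?thesis
      unfolding partial_u_def[of "partial_u ?X"] by (rule vector_derivative_at)
  qed
  have Xuv: "partial_v (partial_u ?X) u \<theta> = vector [- sin \<theta>, cos \<theta>, 0]"
    unfolding partial_v_def Xu[OF zu]
    by (rule vector_derivative_at, rule has_vector_derivative_vector_3)
       (auto intro!: derivative_eq_intros)
  have Xvv: "partial_v (partial_v ?X) u \<theta> = vector [- u * cos \<theta>, - u * sin \<theta>, 0]"
    unfolding partial_v_def[of "partial_v ?X"] Xv
    by (rule vector_derivative_at, rule has_vector_derivative_vector_3)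
       (auto intro!: derivative_eq_intros)
  \<comment> \<open>\<open>m\<close> will turn out to be the coefficient \<open>g11\<close>, and
    \<eta> * m is its absolute value, so \<open>w\<close> is the Lorentzian length of the tangent to
    the profile.\<close>
  define P m w where "P = p u" and "m = 1 - P\<^sup>2" and "w = sqrt (\<eta> * m)"
  have m: "m \<noteq> 0" "\<eta> = sgn m" "\<eta> * m > 0" "\<eta>\<^sup>2 = 1"
    using e by (auto simp: m_def P_def sgn_if split: if_splits)
  then have w: "w > 0" "w\<^sup>2 = \<eta> * m" by (auto simp: w_def)
  define n where "n = lorentz_cross (partial_u ?X u \<theta>) (partial_v ?X u \<theta>)"
  have n: "n = vector [- (P * u * cos \<theta>), - (P * u * sin \<theta>), - u]"
    unfolding n_def Xu[OF zu] Xv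
    by (simp add: lorentz_cross_def P_def vec_eq_iff forall_3)
       (use sin_cos_squared_add[of \<theta>] in algebra)
  have nn: "lorentz n n = - (u\<^sup>2 * m)"
    using sin_cos_squared_add[of \<theta>] unfolding n lorentz_def vector_3 m_def by algebra
  have "sqrt \<bar>lorentz n n\<bar> = u * w"
  proof -
    have "\<bar>m\<bar> = \<eta> * m"
      by (simp add: m(2) abs_sgn mult.commute)
    then have "\<bar>lorentz n n\<bar> = u\<^sup>2 * w\<^sup>2"
      using w(2) by (simp add: nn abs_mult)
    then show ?thesis using u w(1) by (simp add: real_sqrt_mult)
  qed
  then have N: "unit_normal ?X u \<theta> = (1 / (u * w)) *\<^sub>R n"
    by (simp add: unit_normal_def Let_def flip: n_def)
  have h: "h11 ?X u \<theta> = q / w" "h12 ?X u \<theta> = 0" "h22 ?X u \<theta> = u * P / w"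
  proof -
    show "h11 ?X u \<theta> = q / w" "h12 ?X u \<theta> = 0"
      using u w by (simp_all add: h11_def h12_def Xuu Xuv N n lorentz_def)
    have "h22 ?X u \<theta> = 1 / (u * w) * (u * u * P * ((sin \<theta>)\<^sup>2 + (cos \<theta>)\<^sup>2))"
      unfolding h22_def Xvv N n lorentz_def vector_scaleR_component vector_3 real_scaleR_def
      by algebra
    then show "h22 ?X u \<theta> = u * P / w"
      using u by (simp add: sin_cos_squared_add)
  qed
  have g: "g11 ?X u \<theta> = m" "g12 ?X u \<theta> = 0" "g22 ?X u \<theta> = u\<^sup>2"
  proof -
    have "g11 ?X u \<theta> = (cos \<theta>)\<^sup>2 + (sin \<theta>)\<^sup>2 - P\<^sup>2"
      by (simp add: g11_def Xu[OF zu] lorentz_def P_def power2_eq_square)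
    then show "g11 ?X u \<theta> = m" by (simp add: m_def)
    show "g12 ?X u \<theta> = 0"
      by (simp add: g12_def Xu[OF zu] Xv lorentz_def)
    show "g22 ?X u \<theta> = u\<^sup>2"
      using sin_cos_squared_add[of \<theta>] unfolding g22_def Xv lorentz_def vector_3 by algebra
  qed
  have s: "normal_sign ?X u \<theta> = - \<eta>"
  proof -
    have "sgn (m * u\<^sup>2) = \<eta>" using u m(2) by (simp add: sgn_mult)
    then show ?thesis by (simp add: normal_sign_eq g)
  qed
  \<comment> \<open>The factor \<eta> squared comes from the sign of the normal, which enters H once
    and the product with K twice. It is 1 and disappears in the next step.\<close>
  have "skew_discriminant ?X u \<theta>
      = \<eta>\<^sup>2 * ((u * P * m + u\<^sup>2 * q)\<^sup>2 / (4 * w\<^sup>2 * (u\<^sup>2 * m)\<^sup>2) - q * (u * P) / (w\<^sup>2 * (u\<^sup>2 * m)))"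
  proof -
    have "m * (u * P / w) - 2 * 0 * 0 + u\<^sup>2 * (q / w) = (u * P * m + u\<^sup>2 * q) / w"
      by (simp add: add_divide_distrib)
    then have "skew_discriminant ?X u \<theta> = (- \<eta> / 2 * ((u * P * m + u\<^sup>2 * q) / w / (m * u\<^sup>2)))\<^sup>2
        - \<eta>\<^sup>2 * (q / w * (u * P / w) / (m * u\<^sup>2))"
      unfolding skew_discriminant_def mean_curvature_def gauss_curvature_def s h g
      by (simp add: power2_eq_square)
    then show ?thesis
      by (simp add: power_divide power_mult_distrib right_diff_distrib mult_ac power2_eq_square[of w])
  qed
  also have "\<dots> = ((u * P * m + u\<^sup>2 * q)\<^sup>2 - 4 * (q * (u * P)) * (u\<^sup>2 * m)) / (4 * w\<^sup>2 * (u\<^sup>2 * m)\<^sup>2)"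
  proof -
    have "b / (w\<^sup>2 * M) = (4 * b * M) / (4 * w\<^sup>2 * M\<^sup>2)" if "M \<noteq> 0" for b M
      using that by (simp add: power2_eq_square)
    from this[of "u\<^sup>2 * m"] show ?thesis
      using u m(1,4) by (simp add: diff_divide_distrib)
  qed
  \<comment> \<open>This is (a + b)^2 - 4ab = (a - b)^2 with a = u P m and b = u^2 q, which turns
    the sum of the principal curvatures into their difference.\<close>
  also have "(u * P * m + u\<^sup>2 * q)\<^sup>2 - 4 * (q * (u * P)) * (u\<^sup>2 * m) = u\<^sup>2 * (u * q - P * m)\<^sup>2"
    by algebra
  also have "u\<^sup>2 * (u * q - P * m)\<^sup>2 / (4 * w\<^sup>2 * (u\<^sup>2 * m)\<^sup>2) = (u * q - P * m)\<^sup>2 / (4 * u\<^sup>2 * w\<^sup>2 * m\<^sup>2)"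
  proof -
    have "U * x / (4 * w\<^sup>2 * (U * m)\<^sup>2) = x / (4 * U * w\<^sup>2 * m\<^sup>2)" if "U \<noteq> 0" for U x
      using that by (simp add: power_mult_distrib power2_eq_square[of U])
    from this[of "u\<^sup>2"] show ?thesis using u by simp
  qed
  finally show ?thesis
    unfolding w(2) by (simp add: m_def P_def)
qed

section \<open>The function A attached to a profile, and its derivative\<close>

text \<open>The quotient rule produces the same factor u q - p (1 - p^2) as the skew discriminant;
  this coincidence is what links A' to S.\<close>

lemma has_real_derivative_profile_invariant:
  assumes u: "(u::real) > 0" and p: "(p has_real_derivative q) (at u)"
    and e: "\<eta> = sgn (1 - (p u)\<^sup>2)" "\<eta> \<in> {-1, 1}"
  shows "((\<lambda>t. p t / (t * sqrt (\<eta> * (1 - (p t)\<^sup>2)))) has_real_derivative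
    \<eta> * (u * q - p u * (1 - (p u)\<^sup>2)) / (u\<^sup>2 * (sqrt (\<eta> * (1 - (p u)\<^sup>2)))^3)) (at u)"
proof -
  define P m w where "P = p u" and "m = 1 - P\<^sup>2" and "w = sqrt (\<eta> * m)"
  have m: "\<eta> * m > 0"
    using e by (auto simp: m_def P_def sgn_if split: if_splits)
  then have w: "w > 0" "w * w = \<eta> * m" by (auto simp: w_def)
  have sq: "((\<lambda>t. sqrt (\<eta> * (1 - (p t)\<^sup>2))) has_real_derivative - \<eta> * P * q / w) (at u)"
  proof -
    have "((\<lambda>t. \<eta> * (1 - (p t)\<^sup>2)) has_real_derivative - 2 * \<eta> * P * q) (at u)"
      by (auto intro!: derivative_eq_intros p simp: P_def)
    from DERIV_chain2[OF DERIV_real_sqrt this] m show ?thesis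
      by (simp add: inverse_eq_divide mult.assoc flip: P_def m_def w_def)
  qed
  have "((\<lambda>t. p t / (t * sqrt (\<eta> * (1 - (p t)\<^sup>2)))) has_real_derivative
    (q * (u * w) - P * (w + u * (- \<eta> * P * q / w))) / ((u * w) * (u * w))) (at u)"
  proof -
    have "((\<lambda>t. t * sqrt (\<eta> * (1 - (p t)\<^sup>2))) has_real_derivative w + u * (- \<eta> * P * q / w)) (at u)"
      using DERIV_mult[OF DERIV_ident sq] by (simp add: add.commute mult.commute flip: P_def m_def w_def)
    from DERIV_divide[OF p this] u w(1) show ?thesis
      by (simp flip: P_def m_def w_def)
  qed
  also have "(q * (u * w) - P * (w + u * (- \<eta> * P * q / w))) / ((u * w) * (u * w))
      = (q * u * (w * w) - P * (w * w) + u * \<eta> * P\<^sup>2 * q) / (u\<^sup>2 * w^3)"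
    using u w(1) by (simp add: divide_simps) (simp add: power2_eq_square power3_eq_cube algebra_simps)
  \<comment> \<open>After replacing \<open>w * w\<close> by \<eta> * m, the two terms with
    \<open>q\<close> combine because m + P^2 = 1.\<close>
  also have "\<dots> = \<eta> * (u * q - P * m) / (u\<^sup>2 * w^3)"
    unfolding w(2) by (simp add: m_def power2_eq_square algebra_simps)
  finally show ?thesis
    by (simp add: P_def m_def w_def)
qed

text \<open>\<open>B\<close> only has to agree with the invariant near \<open>u\<close>. This covers
  \<open>A\<close> itself in the direct part and \<open>s * A\<close> in the converse, where the
  square removes the sign.\<close>

lemma skew_discriminant_eq_deriv:
  assumes u: "0 < u" and z: "\<forall>\<^sub>F t in nhds u. (z has_real_derivative p t) (at t)"
    and p: "(p has_real_derivative q) (at u)" and e: "\<eta> = sgn (1 - (p u)\<^sup>2)" "\<eta> \<in> {-1, 1}"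
    and A: "\<forall>\<^sub>F t in nhds u. B t = p t / (t * sqrt (\<eta> * (1 - (p t)\<^sup>2)))"
    and B: "(B has_real_derivative D) (at u)"
  shows "skew_discriminant (revolution (profile_curve z)) u \<theta> = u\<^sup>2 / 4 * D\<^sup>2"
proof -
  define m w where "m = 1 - (p u)\<^sup>2" and "w = sqrt (\<eta> * m)"
  have m: "\<eta> * m > 0" "\<eta>\<^sup>2 = 1" "m \<noteq> 0"
    using e by (auto simp: m_def sgn_if split: if_splits)
  then have w: "w > 0" "w\<^sup>2 = \<eta> * m" by (auto simp: w_def)
  have "(B has_real_derivative \<eta> * (u * q - p u * m) / (u\<^sup>2 * w^3)) (at u)"
    using has_real_derivative_profile_invariant[OF u p e] DERIV_cong_ev[OF refl A refl]
    by (simp add: m_def w_def)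
  with B have D: "D = \<eta> * (u * q - p u * m) / (u\<^sup>2 * w^3)"
    by (rule DERIV_unique)
  \<comment> \<open>Squaring \<open>D\<close> gives the denominator \<open>w^6\<close>, which is
    |m|^3, the power of \<open>m\<close> in the discriminant.\<close>
  have "w^6 = (w\<^sup>2)^3" by (simp flip: power_mult)
  also have "\<dots> = \<eta>\<^sup>2 * ((\<eta> * m) * m\<^sup>2)"
    unfolding w(2) by (simp add: power2_eq_square power3_eq_cube)
  finally have "w^6 = (\<eta> * m) * m\<^sup>2" using m by simp
  then have D2: "D\<^sup>2 = (u * q - p u * m)\<^sup>2 / ((u\<^sup>2)\<^sup>2 * ((\<eta> * m) * m\<^sup>2))"
    using m(2) unfolding D by (simp add: power_divide power_mult_distrib flip: power_mult)
  have "U / 4 * (x / (U\<^sup>2 * k)) = x / (4 * U * k)" if "U \<noteq> 0" for U x k :: real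
    using that by (simp add: power2_eq_square)
  from this[of "u\<^sup>2"] have "u\<^sup>2 / 4 * D\<^sup>2 = (u * q - p u * m)\<^sup>2 / (4 * u\<^sup>2 * ((\<eta> * m) * m\<^sup>2))"
    using u unfolding D2 by simp
  then show ?thesis
    using skew_discriminant_revolution[OF u z p e] by (simp add: m_def mult.assoc)
qed

text \<open>The first two coordinates of the profile curve are smooth, so regularity is a matter of
  the third one alone; this moves between the vector formulation and scalar derivatives of
  \<open>z\<close>.\<close>

lemma C2_on_profile_curve_iff:
  "C2_on I (profile_curve z) \<longleftrightarrow>
     (\<exists>p q. (\<forall>u\<in>I. (z has_real_derivative p u) (at u) \<and> (p has_real_derivative q u) (at u)) \<and>
            continuous_on I q)" (is "?L \<longleftrightarrow> ?R")
proof
  assume ?L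
  then obtain a b where ab: "\<And>u. u \<in> I \<Longrightarrow> (profile_curve z has_vector_derivative a u) (at u)"
    "\<And>u. u \<in> I \<Longrightarrow> (a has_vector_derivative b u) (at u)" "continuous_on I b"
    by (auto simp: C2_on_def)
  have comp: "((\<lambda>t. f t $ 3) has_real_derivative f' $ 3) (at u)"
    if "(f has_vector_derivative f') (at u)" for f :: "real \<Rightarrow> real^3" and f' u
    using bounded_linear.has_vector_derivative[OF bounded_linear_vec_nth that]
    by (simp add: has_real_derivative_iff_has_vector_derivative)
  have "(\<lambda>t. profile_curve z t $ 3) = z" by (simp add: profile_curve_def)
  then have "\<forall>u\<in>I. (z has_real_derivative a u $ 3) (at u) \<and> ((\<lambda>u. a u $ 3) has_real_derivative b u $ 3) (at u)"
    using comp[OF ab(1)] comp[OF ab(2)] by auto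
  moreover have "continuous_on I (\<lambda>u. b u $ 3)"
    by (intro continuous_intros ab)
  ultimately show ?R
    by (intro exI[of _ "\<lambda>u. a u $ 3"] exI[of _ "\<lambda>u. b u $ 3"] conjI)
next
  assume ?R
  then obtain p q where pq: "\<And>u. u \<in> I \<Longrightarrow> (z has_real_derivative p u) (at u)"
    "\<And>u. u \<in> I \<Longrightarrow> (p has_real_derivative q u) (at u)" "continuous_on I q" by auto
  have "(profile_curve z has_vector_derivative vector [1, 0, p u]) (at u)" if "u \<in> I" for u
    unfolding profile_curve_def[abs_def] using pq(1)[OF that]
    by (intro has_vector_derivative_vector_3) (auto intro!: derivative_eq_intros)
  moreover have "((\<lambda>u. vector [1, 0, p u] :: real^3) has_vector_derivative vector [0, 0, q u]) (at u)" if "u \<in> I" for u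
    using pq(2)[OF that]
    by (intro has_vector_derivative_vector_3) (auto intro!: derivative_eq_intros)
  moreover have "continuous_on I (\<lambda>u. vector [0, 0, q u] :: real^3)"
  proof -
    have "vector [0, 0, q u] = q u *\<^sub>R (axis 3 1 :: real^3)" for u
      by (simp add: vec_eq_iff forall_3 axis_def)
    then show ?thesis
      using pq(3) by (simp add: continuous_on_scaleR)
  qed
  ultimately show ?L unfolding C2_on_def
    by (intro exI[of _ "\<lambda>u. vector [1, 0, p u]"] exI[of _ "\<lambda>u. vector [0, 0, q u]"]) auto
qed

section \<open>Recovering the slope of the profile from A\<close>

text \<open>Inverts the passage from slope to invariant: with r^2 = \<eta> + u^2 a^2 one gets 1 -
  p^2 = \<eta> / r^2. Hence the sign is \<eta>, the square root in the denominator is 1 / r, and the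
  factor r cancels.\<close>

lemma profile_slope_from_invariant:
  assumes "0 < (u::real)" and \<eta>: "\<eta> \<in> {-1, 1}" and s: "s \<in> {-1, 1}" and R: "0 < \<eta> + u\<^sup>2 * a\<^sup>2"
    and p: "p = s * (u * a / sqrt (\<eta> + u\<^sup>2 * a\<^sup>2))"
  shows "sgn (1 - p\<^sup>2) = \<eta>" and "p / (u * sqrt (\<eta> * (1 - p\<^sup>2))) = s * a"
proof -
  define r where "r = sqrt (\<eta> + u\<^sup>2 * a\<^sup>2)"
  have r: "r > 0" "r\<^sup>2 = \<eta> + u\<^sup>2 * a\<^sup>2" using R by (auto simp: r_def)
  have "p\<^sup>2 = (r\<^sup>2 - \<eta>) / r\<^sup>2"
    using s by (auto simp: p power_divide power_mult_distrib r(2) simp flip: r_def)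
  then have m: "1 - p\<^sup>2 = \<eta> / r\<^sup>2" using r(1) by (simp add: diff_divide_distrib)
  show "sgn (1 - p\<^sup>2) = \<eta>" unfolding m using \<eta> r(1) by auto
  have "\<eta> * (1 - p\<^sup>2) = (1 / r)\<^sup>2" unfolding m using \<eta> by (auto simp: power_divide)
  then have "sqrt (\<eta> * (1 - p\<^sup>2)) = 1 / r" using r(1) by (simp only: real_sqrt_abs) simp
  then show "p / (u * sqrt (\<eta> * (1 - p\<^sup>2))) = s * a"
    using r(1) \<open>0 < u\<close> by (simp add: p flip: r_def)
qed

text \<open>With x = u A, the derivative of x / sqrt(\<eta> + x^2) is \<eta> x' / (\<eta> +
  x^2)^(3/2). It supplies z'' in the converse and shows that z'' is continuous as soon as A'
  is.\<close>

lemma profile_slope_has_real_derivative: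
  assumes R: "0 < \<eta> + (u::real)\<^sup>2 * (A u)\<^sup>2" and A: "(A has_real_derivative D) (at u)"
  shows "((\<lambda>t. t * A t / sqrt (\<eta> + t\<^sup>2 * (A t)\<^sup>2)) has_real_derivative
    \<eta> * (A u + u * D) / (sqrt (\<eta> + u\<^sup>2 * (A u)\<^sup>2))^3) (at u)"
proof -
  define x x' r where "x = u * A u" and "x' = A u + u * D" and "r = sqrt (\<eta> + u\<^sup>2 * (A u)\<^sup>2)"
  have r: "r > 0" "r * r = \<eta> + x\<^sup>2" using R by (auto simp: r_def x_def power_mult_distrib)
  have "((\<lambda>t. \<eta> + t\<^sup>2 * (A t)\<^sup>2) has_real_derivative 2 * x * x') (at u)"
    by (auto intro!: derivative_eq_intros A simp: x_def x'_def algebra_simps power2_eq_square)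
  from DERIV_chain2[OF DERIV_real_sqrt this] R
  have sq: "((\<lambda>t. sqrt (\<eta> + t\<^sup>2 * (A t)\<^sup>2)) has_real_derivative x * x' / r) (at u)"
    by (simp add: inverse_eq_divide flip: r_def)
  have num: "((\<lambda>t. t * A t) has_real_derivative x') (at u)"
    by (auto intro!: derivative_eq_intros A simp: x'_def)
  have "((\<lambda>t. t * A t / sqrt (\<eta> + t\<^sup>2 * (A t)\<^sup>2)) has_real_derivative
      (x' * r - x * (x * x' / r)) / (r * r)) (at u)"
    using DERIV_divide[OF num sq] r(1) by (simp flip: r_def x_def)
  also have "(x' * r - x * (x * x' / r)) / (r * r) = x' * (r * r - x\<^sup>2) / r^3"
    using r(1) by (simp add: divide_simps) (simp add: power2_eq_square power3_eq_cube algebra_simps)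
  also have "r * r - x\<^sup>2 = \<eta>" by (simp add: r(2))
  finally show ?thesis by (simp add: x'_def r_def mult.commute)
qed

theorem mainTheorem6:
  fixes I :: "real set"
  assumes "open I" and "is_interval I" and "I \<subseteq> {0<..}"
  shows
    "(\<forall>z A :: real \<Rightarrow> real. \<forall>\<eta> :: real.
        C2_on I (profile_curve z) \<and>
        \<eta> \<in> {-1, 1} \<and>
        (\<forall>u\<in>I. \<eta> = sgn (1 - (deriv z u)\<^sup>2)) \<and>
        (\<forall>u\<in>I. A u = deriv z u / (u * sqrt (\<eta> * (1 - (deriv z u)\<^sup>2))))
        \<longrightarrow>
        (\<exists>S :: real \<Rightarrow> real.
           (\<forall>u\<in>I. \<forall>\<theta>. skew_discriminant (revolution (profile_curve z)) u \<theta> \<ge> 0 \<and>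
                       skew_curvature (revolution (profile_curve z)) u \<theta> = S u) \<and>
           (\<forall>u\<in>I. A differentiable (at u) \<and> (S u)\<^sup>2 = u\<^sup>2 / 4 * (deriv A u)\<^sup>2) \<and>
           (\<exists>\<sigma> F a0. sign_function_on I \<sigma> \<and>
              antiderivative_on I (\<lambda>v. \<sigma> v * (S v / v)) F \<and>
              (\<forall>u\<in>I. A u = 2 * F u + a0)) \<and>
           (\<forall>J. is_interval J \<and> J \<subseteq> I \<and> (\<forall>u\<in>J. S u \<noteq> 0) \<longrightarrow>
              (\<exists>s\<in>{-1, 1}. \<exists>F a0. antiderivative_on J (\<lambda>v. S v / v) F \<and>
                 (\<forall>u\<in>J. A u = s * 2 * F u + a0)))) \<and>
        (\<forall>u\<in>I. 0 < \<eta> + u\<^sup>2 * (A u)\<^sup>2 \<and>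
               (deriv z u)\<^sup>2 = \<eta> * u\<^sup>2 * (A u)\<^sup>2 / (1 + \<eta> * u\<^sup>2 * (A u)\<^sup>2)) \<and>
        (\<exists>s\<in>{-1, 1}. \<exists>G z0.
           antiderivative_on I (\<lambda>v. v * A v / sqrt (\<eta> + v\<^sup>2 * (A v)\<^sup>2)) G \<and>
           (\<forall>u\<in>I. z u = s * G u + z0)))
     \<and>
     (\<forall>S \<sigma> F A G z :: real \<Rightarrow> real. \<forall>\<eta> s a0 z0 :: real.
        (\<forall>u\<in>I. S u \<ge> 0) \<and>
        sign_function_on I \<sigma> \<and>
        antiderivative_on I (\<lambda>v. \<sigma> v * (S v / v)) F \<and>
        (\<forall>u\<in>I. A u = 2 * F u + a0) \<and>
        \<eta> \<in> {-1, 1} \<and>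
        (\<forall>u\<in>I. 0 < \<eta> + u\<^sup>2 * (A u)\<^sup>2) \<and>
        antiderivative_on I (\<lambda>v. v * A v / sqrt (\<eta> + v\<^sup>2 * (A v)\<^sup>2)) G \<and>
        s \<in> {-1, 1} \<and>
        (\<forall>u\<in>I. z u = s * G u + z0)
        \<longrightarrow>
        (continuous_on I S \<longrightarrow> C2_on I (profile_curve z)) \<and>
        (\<forall>u\<in>I. sgn (1 - (deriv z u)\<^sup>2) = \<eta>) \<and>
        (\<forall>u\<in>I. \<forall>\<theta>. skew_curvature (revolution (profile_curve z)) u \<theta> = S u))"
proof ((rule conjI; intro allI impI), goal_cases)
  have I_pos: "0 < u" if "u \<in> I" for u using assms(3) that by auto
  \<comment> \<open>As \<open>I\<close> is open, identities on \<open>I\<close> hold near each of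
    its points and may be differentiated there.\<close>
  have ev: "\<forall>\<^sub>F t in nhds u. P t" if "u \<in> I" "\<And>t. t \<in> I \<Longrightarrow> P t" for P and u :: real
    using eventually_nhds_in_open[OF assms(1) that(1)] by (rule eventually_mono) (rule that(2))
  {

    \<comment> \<open>From the profile to A, and from A back to z\<close>
    case (1 z A \<eta>)
    then obtain p q where p: "\<And>u. u \<in> I \<Longrightarrow> (z has_real_derivative p u) (at u)"
      and q: "\<And>u. u \<in> I \<Longrightarrow> (p has_real_derivative q u) (at u)"
      by (auto simp: C2_on_profile_curve_iff)
    have dz: "deriv z u = p u" if "u \<in> I" for u using p[OF that] by (rule DERIV_imp_deriv)
    have \<eta>: "\<eta> \<in> {-1, 1}" and sg: "\<And>u. u \<in> I \<Longrightarrow> \<eta> = sgn (1 - (p u)\<^sup>2)"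
      and A: "\<And>u. u \<in> I \<Longrightarrow> A u = p u / (u * sqrt (\<eta> * (1 - (p u)\<^sup>2)))"
      using 1 dz by auto
    have "\<exists>D. (A has_real_derivative D) (at u)" if u: "u \<in> I" for u
    proof -
      have "\<forall>\<^sub>F t in nhds u. A t = p t / (t * sqrt (\<eta> * (1 - (p t)\<^sup>2)))"
        by (rule ev[OF u A])
      from DERIV_cong_ev[OF refl this refl] show ?thesis
        using has_real_derivative_profile_invariant[OF I_pos[OF u] q[OF u] sg[OF u] \<eta>] by blast
    qed
    then obtain D where D: "\<And>u. u \<in> I \<Longrightarrow> (A has_real_derivative D u) (at u)" by metis
    have disc: "skew_discriminant (revolution (profile_curve z)) u \<theta> = u\<^sup>2 / 4 * (D u)\<^sup>2" if u: "u \<in> I" for u \<theta>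
      by (rule skew_discriminant_eq_deriv[OF I_pos[OF u] ev[OF u p] q[OF u] sg[OF u] \<eta> ev[OF u A] D[OF u]])
    \<comment> \<open>The nonnegative square root of the discriminant just computed, using u > 0 on
      \<open>I\<close>.\<close>
    define S where "S = (\<lambda>u. u / 2 * \<bar>D u\<bar>)"
    have S: "u\<^sup>2 / 4 * (D u)\<^sup>2 = (S u)\<^sup>2" for u
      by (simp add: S_def power_mult_distrib power_divide)
    have S_div: "S u / u = \<bar>D u\<bar> / 2" if "u \<in> I" for u
      using I_pos[OF that] by (simp add: S_def)
    have half: "((\<lambda>t. s * A t / 2) has_real_derivative s * D u / 2) (at u)" if "u \<in> I" for u s
      by (auto intro!: derivative_eq_intros D that)
    \<comment> \<open>The definition of A yields \<eta> + u^2 A^2 = 1 / (\<eta> m), so the slope is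
      u A divided by the root of this quantity, with a plus sign: A has the sign of z'.\<close>
    have key: "0 < \<eta> + u\<^sup>2 * (A u)\<^sup>2 \<and> p u = u * A u / sqrt (\<eta> + u\<^sup>2 * (A u)\<^sup>2)" if u: "u \<in> I" for u
    proof -
      define m where "m = 1 - (p u)\<^sup>2"
      have m: "\<eta> * m > 0" "\<eta> * \<eta> = 1" using \<eta> sg[OF u] by (auto simp: m_def sgn_if split: if_splits)
      have uA: "u * A u = p u / sqrt (\<eta> * m)"
        using I_pos[OF u] by (simp add: A[OF u] m_def)
      have "u\<^sup>2 * (A u)\<^sup>2 = (1 - m) / (\<eta> * m)"
        using m(1) unfolding power_mult_distrib[symmetric] uA by (simp add: power_divide m_def)
      also have "\<dots> = 1 / (\<eta> * m) - \<eta>"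
        using m \<eta> by (auto simp: diff_divide_distrib)
      finally have e: "\<eta> + u\<^sup>2 * (A u)\<^sup>2 = 1 / (\<eta> * m)" by simp
      show ?thesis
        unfolding e uA using m(1) by (auto simp: real_sqrt_divide)
    qed
    show ?case
    proof (intro conjI ballI)
      show "\<exists>S. (\<forall>u\<in>I. \<forall>\<theta>. skew_discriminant (revolution (profile_curve z)) u \<theta> \<ge> 0 \<and>
                  skew_curvature (revolution (profile_curve z)) u \<theta> = S u) \<and>
             (\<forall>u\<in>I. A differentiable (at u) \<and> (S u)\<^sup>2 = u\<^sup>2 / 4 * (deriv A u)\<^sup>2) \<and>
             (\<exists>\<sigma> F a0. sign_function_on I \<sigma> \<and>
                antiderivative_on I (\<lambda>v. \<sigma> v * (S v / v)) F \<and>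
                (\<forall>u\<in>I. A u = 2 * F u + a0)) \<and>
             (\<forall>J. is_interval J \<and> J \<subseteq> I \<and> (\<forall>u\<in>J. S u \<noteq> 0) \<longrightarrow>
                (\<exists>s\<in>{-1, 1}. \<exists>F a0. antiderivative_on J (\<lambda>v. S v / v) F \<and>
                   (\<forall>u\<in>J. A u = s * 2 * F u + a0)))"
      proof (rule exI[of _ S], intro conjI ballI allI impI)
        fix u \<theta> assume u: "u \<in> I"
        show "skew_discriminant (revolution (profile_curve z)) u \<theta> \<ge> 0"
          by (simp add: disc[OF u])
        have "S u \<ge> 0" using I_pos[OF u] by (simp add: S_def)
        then show "skew_curvature (revolution (profile_curve z)) u \<theta> = S u"
          by (simp only: skew_curvature_def disc[OF u] S real_sqrt_abs abs_of_nonneg)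
      next
        fix u assume u: "u \<in> I"
        show "A differentiable (at u)" using D[OF u] by (auto simp: real_differentiable_def)
        show "(S u)\<^sup>2 = u\<^sup>2 / 4 * (deriv A u)\<^sup>2" by (simp only: DERIV_imp_deriv[OF D[OF u]] S)
      next
        \<comment> \<open>The sign of A'. The value 1 chosen at zeros of A' is harmless, as S
          vanishes there. The antiderivative is then A / 2 with constant 0.\<close>
        define \<sigma> where "\<sigma> = (\<lambda>u. if D u < 0 then -1 else 1 :: real)"
        have "\<sigma> u * (S u / u) = D u / 2" if "u \<in> I" for u
          by (simp add: S_div[OF that] \<sigma>_def)
        then have "antiderivative_on I (\<lambda>v. \<sigma> v * (S v / v)) (\<lambda>t. A t / 2)"
          using half[of _ 1] unfolding antiderivative_on_def mult_1 by metis
        moreover have "sign_function_on I \<sigma>" by (simp add: sign_function_on_def \<sigma>_def)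
        ultimately show "\<exists>\<sigma> F a0. sign_function_on I \<sigma> \<and>
            antiderivative_on I (\<lambda>v. \<sigma> v * (S v / v)) F \<and> (\<forall>u\<in>I. A u = 2 * F u + a0)"
          by (intro exI[of _ \<sigma>] exI[of _ "\<lambda>t. A t / 2"] exI[of _ 0]) simp
      next
        fix J assume J: "is_interval J \<and> J \<subseteq> I \<and> (\<forall>u\<in>J. S u \<noteq> 0)"
        then have nz: "D u \<noteq> 0" if "u \<in> J" for u using that by (auto simp: S_def)
        \<comment> \<open>S vanishes exactly where A' does on \<open>J\<close>, so the Darboux
          property fixes the sign of A'. For empty \<open>J\<close> either sign serves.\<close>
        have "\<exists>s\<in>{-1, 1}. \<forall>u\<in>J. sgn (D u) = s"
        proof (cases "J = {}")
          case False
          then obtain x where x: "x \<in> J" by blast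
          have "sgn (D u) = sgn (D x)" if "u \<in> J" for u
            using sgn_derivative_constant[of J A D u x] J D nz that x by blast
          moreover have "sgn (D x) \<in> {-1, 1}" using nz[OF x] by (simp add: sgn_if)
          ultimately show ?thesis by blast
        qed auto
        then obtain s where s: "s \<in> {-1, 1}" "\<And>u. u \<in> J \<Longrightarrow> sgn (D u) = s" by blast
        have "s * D u / 2 = S u / u" if "u \<in> J" for u
          using S_div[of u] J that s(2)[OF that] by (auto simp: abs_sgn mult.commute)
        then have "antiderivative_on J (\<lambda>v. S v / v) (\<lambda>t. s * A t / 2)"
          using half[of _ s] J unfolding antiderivative_on_def by (metis subsetD)
        moreover have "\<forall>u\<in>J. A u = s * 2 * (s * A u / 2) + 0" using s(1) by auto
        ultimately show "\<exists>s\<in>{-1, 1}. \<exists>F a0. antiderivative_on J (\<lambda>v. S v / v) F \<and>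
            (\<forall>u\<in>J. A u = s * 2 * F u + a0)"
          using s(1) by blast
      qed
    next
      fix u assume u: "u \<in> I"
      show "0 < \<eta> + u\<^sup>2 * (A u)\<^sup>2" using key[OF u] by blast
      have "\<eta> * u\<^sup>2 * (A u)\<^sup>2 / (1 + \<eta> * u\<^sup>2 * (A u)\<^sup>2) = u\<^sup>2 * (A u)\<^sup>2 / (\<eta> + u\<^sup>2 * (A u)\<^sup>2)"
      proof -
        \<comment> \<open>Both sides of the fraction are multiplied by \<eta>, whose square is
          1.\<close>
        have "\<eta> * x / (1 + \<eta> * x) = x / (\<eta> + x)" for x
          using \<eta> minus_divide_divide[of x "x - 1"] by (auto simp: algebra_simps)
        from this[of "u\<^sup>2 * (A u)\<^sup>2"] show ?thesis by (simp only: mult.assoc)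
      qed
      then show "(deriv z u)\<^sup>2 = \<eta> * u\<^sup>2 * (A u)\<^sup>2 / (1 + \<eta> * u\<^sup>2 * (A u)\<^sup>2)"
        using key[OF u] by (simp add: dz[OF u] power_divide power_mult_distrib)
    next
      \<comment> \<open>By \<open>key\<close>, \<open>z\<close> itself is an antiderivative, so the
        outer sign is 1 and z0 = 0.\<close>
      have "antiderivative_on I (\<lambda>v. v * A v / sqrt (\<eta> + v\<^sup>2 * (A v)\<^sup>2)) z"
        unfolding antiderivative_on_def
      proof
        fix u assume u: "u \<in> I"
        then show "(z has_real_derivative u * A u / sqrt (\<eta> + u\<^sup>2 * (A u)\<^sup>2)) (at u)"
          using p[OF u] key[OF u] by simp
      qed
      then show "\<exists>s\<in>{-1, 1}. \<exists>G z0.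
           antiderivative_on I (\<lambda>v. v * A v / sqrt (\<eta> + v\<^sup>2 * (A v)\<^sup>2)) G \<and>
           (\<forall>u\<in>I. z u = s * G u + z0)"
        by (intro bexI[of _ 1] exI[of _ z] exI[of _ 0]) auto
    qed
  next

    \<comment> \<open>The converse: from a prescribed S to the profile\<close>
    case (2 S \<sigma> F A G z \<eta> s a0 z0)
    then have S0: "\<And>u. u \<in> I \<Longrightarrow> 0 \<le> S u"
      and \<sigma>: "\<And>u. u \<in> I \<Longrightarrow> \<sigma> u \<in> {-1, 1}"
      and F: "\<And>u. u \<in> I \<Longrightarrow> (F has_real_derivative \<sigma> u * (S u / u)) (at u)"
      and AF: "\<And>u. u \<in> I \<Longrightarrow> A u = 2 * F u + a0"
      and \<eta>: "\<eta> \<in> {-1, 1}" and R: "\<And>u. u \<in> I \<Longrightarrow> 0 < \<eta> + u\<^sup>2 * (A u)\<^sup>2"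
      and G: "\<And>u. u \<in> I \<Longrightarrow> (G has_real_derivative u * A u / sqrt (\<eta> + u\<^sup>2 * (A u)\<^sup>2)) (at u)"
      and s: "s \<in> {-1, 1}" and zG: "\<And>u. u \<in> I \<Longrightarrow> z u = s * G u + z0"
      by (auto simp: antiderivative_on_def sign_function_on_def)
    \<comment> \<open>\<open>D\<close>, \<open>p\<close> and \<open>q\<close> are the candidates for
      A', z' and z''.\<close>
    define D where "D = (\<lambda>u. 2 * (\<sigma> u * (S u / u)))"
    define p where "p = (\<lambda>u. s * (u * A u / sqrt (\<eta> + u\<^sup>2 * (A u)\<^sup>2)))"
    define q where "q = (\<lambda>u. s * (\<eta> * (A u + u * D u) / (sqrt (\<eta> + u\<^sup>2 * (A u)\<^sup>2))^3))"
    have D: "(A has_real_derivative D u) (at u)" if u: "u \<in> I" for u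
    proof -
      have "\<forall>\<^sub>F t in nhds u. A t = 2 * F t + a0" by (rule ev[OF u AF])
      moreover have "((\<lambda>t. 2 * F t + a0) has_real_derivative D u) (at u)"
        by (auto intro!: derivative_eq_intros F[OF u] simp: D_def)
      ultimately show ?thesis by (simp only: DERIV_cong_ev[OF refl _ refl])
    qed
    have p: "(z has_real_derivative p u) (at u)" if u: "u \<in> I" for u
    proof -
      have "\<forall>\<^sub>F t in nhds u. z t = s * G t + z0" by (rule ev[OF u zG])
      moreover have "((\<lambda>t. s * G t + z0) has_real_derivative p u) (at u)"
        by (auto intro!: derivative_eq_intros G[OF u] simp: p_def)
      ultimately show ?thesis by (simp only: DERIV_cong_ev[OF refl _ refl])
    qed
    have q: "(p has_real_derivative q u) (at u)" if u: "u \<in> I" for u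
      unfolding p_def q_def
      by (rule DERIV_cmult, rule profile_slope_has_real_derivative[OF R[OF u] D[OF u]])
    \<comment> \<open>The invariant of the constructed profile is \<open>s * A\<close>: the sign in
      front of the integral for z carries over to it.\<close>
    have slope: "\<eta> = sgn (1 - (p u)\<^sup>2)" "s * A u = p u / (u * sqrt (\<eta> * (1 - (p u)\<^sup>2)))"
      if u: "u \<in> I" for u
      using profile_slope_from_invariant[OF I_pos[OF u] \<eta> s R[OF u], of "p u"] by (simp_all add: p_def)
    show ?case
    proof (intro conjI impI ballI allI)
      assume S: "continuous_on I S"
      have "continuous_on I (\<lambda>u. 2 * (S u / u))"
        using I_pos by (intro continuous_intros S) auto
      \<comment> \<open>The sign function need not be continuous, so continuity of S only gives that
        of |A'|. That A' is a derivative then makes A' itself continuous.\<close>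
      moreover have "\<bar>D u\<bar> = 2 * (S u / u)" if "u \<in> I" for u
        using \<sigma>[OF that] S0[OF that] I_pos[OF that] by (auto simp: D_def)
      ultimately have "continuous_on I (\<lambda>u. \<bar>D u\<bar>)" by (simp cong: continuous_on_cong)
      then have D_cont: "continuous_on I D"
        using continuous_on_derivative_if_abs[OF assms(1) D] by blast
      have A_cont: "continuous_on I A"
        using D by (intro continuous_at_imp_continuous_on ballI DERIV_isCont)
      have "continuous_on I q"
        unfolding q_def using R by (intro continuous_intros A_cont D_cont) force
      with p q show "C2_on I (profile_curve z)"
        unfolding C2_on_profile_curve_iff by blast
    next
      fix u assume u: "u \<in> I"
      show "sgn (1 - (deriv z u)\<^sup>2) = \<eta>"
        using slope(1)[OF u] DERIV_imp_deriv[OF p[OF u]] by simp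
    next
      fix u \<theta> assume u: "u \<in> I"
      have "skew_discriminant (revolution (profile_curve z)) u \<theta> = u\<^sup>2 / 4 * (s * D u)\<^sup>2"
        by (rule skew_discriminant_eq_deriv[OF I_pos[OF u] ev[OF u p] q[OF u] slope(1)[OF u] \<eta>
              ev[OF u slope(2)] DERIV_cmult[OF D[OF u]]])
      \<comment> \<open>Squaring removes both \<open>s\<close> and the sign function; S >= 0 then
        lets the square root return S.\<close>
      also have "\<dots> = (S u)\<^sup>2"
        using s \<sigma>[OF u] I_pos[OF u] by (auto simp: D_def power_mult_distrib power_divide)
      finally show "skew_curvature (revolution (profile_curve z)) u \<theta> = S u"
        using S0[OF u] by (simp add: skew_curvature_def)
    qed
  }
qed

end
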